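(* For every integer $k\ge1$, $z_{f_4}^k=\sqrt{M_k/m_k}$.
   Context: Fix reals $0<m_i\le M_i$, $i=1,\dots,k$, indexed so that $M_1/m_1\ge M_2/m_2\ge\cdots\ge M_k/m_k$ (standing assumption of the paper). Let $f_4(c_1,\dots,c_k)=\min(c_1,\dots,c_k)$. Let $\mathcal{S}_{f_4}^k=\{(x_1,\dots,x_k)\in[m_1,M_1]\times\cdots\times[m_k,M_k]: \min(M_1/x_1,\dots,M_k/x_k)=\min(x_1/m_1,\dots,x_k/m_k)\}$ and $z_{f_4}^k=\sup_{(x_1,\dots,x_k)\in\mathcal{S}_{f_4}^k}\min(M_1/x_1,\dots,M_k/x_k)$. *)

theory Defs
  imports "HOL-Analysis.Analysis"
begin

text \<open>A \<open>k\<close>-tuple is a function on indices \<open>1, \<dots>, k\<close>; the values elsewhere are irrelevant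
  (and fixed to be \<open>undefined\<close> for elements of \<open>feasible\<close>).\<close>

definition f4 :: "nat \<Rightarrow> (nat \<Rightarrow> real) \<Rightarrow> real" where
  "f4 k c = Min (c ` {1..k})"

definition feasible ::
  "((nat \<Rightarrow> real) \<Rightarrow> real) \<Rightarrow> nat \<Rightarrow> (nat \<Rightarrow> real) \<Rightarrow> (nat \<Rightarrow> real) \<Rightarrow> (nat \<Rightarrow> real) set" where
  "feasible f k m M =
     {x \<in> (\<Pi>\<^sub>E i\<in>{1..k}. {m i..M i}). f (\<lambda>i. M i / x i) = f (\<lambda>i. x i / m i)}"

text \<open>The supremum is the one on the reals, so it is meaningful only if the set of values is
  nonempty and bounded above.  For \<open>f = f4 k\<close> and \<open>0 < m i \<le> M i\<close> this holds: the tuple of all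
  \<open>sqrt (m i * M i)\<close> is feasible, and every value is at most \<open>M 1 / m 1\<close>.\<close>

definition zval ::
  "((nat \<Rightarrow> real) \<Rightarrow> real) \<Rightarrow> nat \<Rightarrow> (nat \<Rightarrow> real) \<Rightarrow> (nat \<Rightarrow> real) \<Rightarrow> real" where
  "zval f k m M = (SUP x\<in>feasible f k m M. f (\<lambda>i. M i / x i))"

end

theory Submission
  imports Defs
begin

text \<open>The product of \<open>M k / x k\<close> and \<open>x k / m k\<close> is \<open>M k / m k\<close>, so a common lower bound of both
  is at most \<open>sqrt (M k / m k)\<close>. The geometric means \<open>x i = sqrt (m i * M i)\<close> attain this bound,
  because \<open>M i / m i\<close> is smallest at \<open>i = k\<close>.\<close>

lemma f4_le: "i \<in> {1..k} \<Longrightarrow> f4 k c \<le> c i"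
  unfolding f4_def by (rule Min_le) auto

lemma f4_cong: "(\<And>i. i \<in> {1..k} \<Longrightarrow> c i = d i) \<Longrightarrow> f4 k c = f4 k d"
  unfolding f4_def by (metis image_cong)

text \<open>Consecutive inequalities chain together by induction from \<open>k\<close> downwards, so
  the last entry is a lower bound that is itself an entry. This is where the ordering of the ratios
  enters.\<close>

lemma f4_eq_last:
  assumes "1 \<le> k" and "\<And>i. 1 \<le> i \<Longrightarrow> i < k \<Longrightarrow> c (Suc i) \<le> c i"
  shows "f4 k c = c k"
proof -
  have "c k \<le> c i" if "i \<le> k" "1 \<le> i" for i
    using that by (induction rule: inc_induct) (use assms(2) in \<open>force+\<close>)
  then show ?thesis
    unfolding f4_def using assms(1) by (intro Min_eqI) auto
qed

lemma divide_geometric_mean: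
  fixes a b :: real
  assumes "0 < a" "0 < b"
  shows "b / sqrt (a * b) = sqrt (b / a)" and "sqrt (a * b) / a = sqrt (b / a)"
  using assms by (simp_all add: real_sqrt_mult real_sqrt_divide field_simps)

theorem theorem7:
  fixes k :: nat and m M :: "nat \<Rightarrow> real"
  assumes "k \<ge> 1"
    and "\<And>i. i \<in> {1..k} \<Longrightarrow> 0 < m i \<and> m i \<le> M i"
    and "\<And>i. 1 \<le> i \<Longrightarrow> i < k \<Longrightarrow> M i / m i \<ge> M (Suc i) / m (Suc i)"
  shows "zval (f4 k) k m M = sqrt (M k / m k)"
  unfolding zval_def
\<comment> \<open>An attained upper bound is the supremum, so no separate argument for nonemptiness
  or boundedness arises.\<close>
proof (rule cSup_eq_maximum)
  \<comment> \<open>\<open>restrict\<close> gives the value \<open>undefined\<close> outside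
    \<open>{1..k}\<close>, as membership in the extensional product demands.\<close>
  define x where "x = restrict (\<lambda>i. sqrt (m i * M i)) {1..k}"
  have x_range: "x i \<in> {m i..M i}" if "i \<in> {1..k}" for i
  proof -
    have "0 < m i" "m i \<le> M i"
      using assms(2)[OF that] by auto
    then have "m i \<le> sqrt (m i * M i)" "sqrt (m i * M i) \<le> M i"
      by (auto intro!: real_le_rsqrt real_le_lsqrt simp: power2_eq_square)
    then show ?thesis
      using that by (simp add: x_def)
  qed
  have quotients: "M i / x i = sqrt (M i / m i)" "x i / m i = sqrt (M i / m i)"
    if "i \<in> {1..k}" for i
    using divide_geometric_mean[of "m i" "M i"] assms(2)[OF that] that by (auto simp: x_def)
  have last: "f4 k (\<lambda>i. sqrt (M i / m i)) = sqrt (M k / m k)"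
    using assms(1,3) by (intro f4_eq_last) auto
  have "f4 k (\<lambda>i. M i / x i) = sqrt (M k / m k)" "f4 k (\<lambda>i. x i / m i) = sqrt (M k / m k)"
    unfolding last[symmetric] by (intro f4_cong quotients; assumption)+
  moreover have "x \<in> (\<Pi>\<^sub>E i\<in>{1..k}. {m i..M i})"
    using x_range by (auto simp: x_def)
  ultimately show "sqrt (M k / m k) \<in> (\<lambda>x. f4 k (\<lambda>i. M i / x i)) ` feasible (f4 k) k m M"
    unfolding feasible_def by (intro rev_image_eqI[of x]) auto
next
  fix v
  assume "v \<in> (\<lambda>x. f4 k (\<lambda>i. M i / x i)) ` feasible (f4 k) k m M"
  then obtain x where x: "x \<in> (\<Pi>\<^sub>E i\<in>{1..k}. {m i..M i})"
    and v: "v = f4 k (\<lambda>i. M i / x i)" "v = f4 k (\<lambda>i. x i / m i)"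
    unfolding feasible_def by auto
  have k: "k \<in> {1..k}"
    using assms(1) by simp
  have pos: "0 < m k" "0 < x k" "0 < M k"
    using assms(2)[OF k] PiE_mem[OF x k] by auto
  \<comment> \<open>Feasibility makes \<open>v\<close> the minimum of both families, so coordinate
    \<open>k\<close> bounds it in two ways.\<close>
  have bounds: "v \<le> M k / x k" "v \<le> x k / m k"
    using f4_le[OF k, of "\<lambda>i. M i / x i"] f4_le[OF k, of "\<lambda>i. x i / m i"] v by auto
  show "v \<le> sqrt (M k / m k)"
  \<comment> \<open>Multiplying the two bounds is monotone only for nonnegative \<open>v\<close>; a
    negative \<open>v\<close> lies below the square root trivially.\<close>
  proof (cases "0 \<le> v")
    case True
    then have "v * v \<le> (M k / x k) * (x k / m k)"
      using bounds pos by (intro mult_mono) auto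
    then show ?thesis
      using pos by (intro real_le_rsqrt) (simp add: power2_eq_square)
  next
    case False
    moreover have "0 \<le> sqrt (M k / m k)"
      using pos by simp
    ultimately show ?thesis
      by linarith
  qed
qed

end
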